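(* The class P-compressible$'$ is closed under join: if $A, B\subseteq\Sigma^*$ are each either finite or P-compressible, then $A\oplus B$ is either finite or P-compressible.
   Context: $\Sigma=\{0,1\}$. A function $f$ is a compression function for $A\subseteq\Sigma^*$ if $\mathrm{domain}(f)\supseteq A$, $f(A)=\Sigma^*$, and $f(a)\neq f(b)$ for all distinct $a,b\in A$. $A$ is P-compressible if some total polynomial-time computable function $f:\Sigma^*\to\Sigma^*$ is a compression function for $A$. P-compressible$'$ is the class of sets that are P-compressible together with all finite subsets of $\Sigma^*$. The join is $A\oplus B=\{x0\mid x\in A\}\cup\{x1\mid x\in B\}$. *)

theory Defs
  imports "HOL-Computational_Algebra.Polynomial"
begin

text \<open>
  A string over \<open>{0,1}\<close> is a \<^typ>\<open>bool list\<close>, where \<^const>\<open>False\<close> is the digit 0 and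
  \<^const>\<open>True\<close> the digit 1.
\<close>

section \<open>Polynomial-time computable string functions\<close>

text \<open>
  Deterministic single-tape Turing machines. The tape is infinite in both directions.
  The tape alphabet is a finite set that contains the blank, both digits and
  arbitrarily many further symbols \<open>Aux i\<close>.
\<close>

datatype sym = Blank | Digit bool | Aux nat

datatype move = Left | Stay | Right

record 'q tm =
  states :: "'q set"
  alphabet :: "sym set"
  start :: 'q
  halt :: 'q
  trans :: "'q \<Rightarrow> sym \<Rightarrow> 'q \<times> sym \<times> move"

definition wf_tm :: "'q tm \<Rightarrow> bool" where
  "wf_tm M \<longleftrightarrow>
     finite (states M) \<and> finite (alphabet M) \<and>
     insert Blank (range Digit) \<subseteq> alphabet M \<and>
     start M \<in> states M \<and> halt M \<in> states M \<and>
     (\<forall>q \<in> states M. \<forall>s \<in> alphabet M. trans M q s \<in> states M \<times> alphabet M \<times> UNIV)"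

text \<open>A configuration consists of the state, the head position and the tape content.\<close>

type_synonym 'q config = "'q \<times> int \<times> (int \<Rightarrow> sym)"

fun shift :: "move \<Rightarrow> int \<Rightarrow> int" where
  "shift Left i = i - 1"
| "shift Stay i = i"
| "shift Right i = i + 1"

definition step :: "'q tm \<Rightarrow> 'q config \<Rightarrow> 'q config" where
  "step M c = (case c of (q, i, T) \<Rightarrow>
     if q = halt M then c
     else (case trans M q (T i) of (q', s, d) \<Rightarrow> (q', shift d i, T(i := s))))"

definition tape_of :: "bool list \<Rightarrow> int \<Rightarrow> sym" where
  "tape_of x i = (if 0 \<le> i \<and> i < int (length x) then Digit (x ! nat i) else Blank)"

text \<open>
  The machine starts on the first cell of its input. It has to halt on the first cell of the
  output, with nothing but the output on the tape. As \<^const>\<open>step\<close> leaves halted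
  configurations unchanged, the equation below says that \<open>M\<close> halts within \<open>t\<close> steps.
\<close>

definition computes_within :: "'q tm \<Rightarrow> bool list \<Rightarrow> bool list \<Rightarrow> nat \<Rightarrow> bool" where
  "computes_within M x y t \<longleftrightarrow>
     (step M ^^ t) (start M, 0, tape_of x) = (halt M, 0, tape_of y)"

text \<open>
  Taking natural numbers as states is no restriction, because state sets are finite.
\<close>

definition poly_time_computable :: "(bool list \<Rightarrow> bool list) \<Rightarrow> bool" where
  "poly_time_computable f \<longleftrightarrow>
     (\<exists>(M :: nat tm) (p :: nat poly). wf_tm M \<and>
        (\<forall>x. computes_within M x (f x) (poly p (length x))))"

section \<open>Compressibility\<close>

text \<open>Compression functions may be partial; totality is part of P-compressibility.\<close>

definition compression_function ::
    "(bool list \<rightharpoonup> bool list) \<Rightarrow> bool list set \<Rightarrow> bool" where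
  "compression_function f A \<longleftrightarrow> A \<subseteq> dom f \<and> ran (f |` A) = UNIV \<and> inj_on f A"

definition P_compressible :: "bool list set \<Rightarrow> bool" where
  "P_compressible A \<longleftrightarrow>
     (\<exists>f. poly_time_computable f \<and> compression_function (\<lambda>x. Some (f x)) A)"

definition P_compressible' :: "bool list set set" where
  "P_compressible' = {A. P_compressible A} \<union> {A. finite A}"

definition join :: "bool list set \<Rightarrow> bool list set \<Rightarrow> bool list set" (infixl "\<oplus>" 65) where
  "A \<oplus> B = {x @ [False] | x. x \<in> A} \<union> {x @ [True] | x. x \<in> B}"

end

theory Submission
  imports Defs "HOL-Library.Countable"
begin

text \<open>
  Let \<open>f\<close> and \<open>g\<close> compress \<open>A\<close> and \<open>B\<close>. Mapping \<open>x0\<close> to \<open>f(x)0\<close> and \<open>x1\<close> to \<open>g(x)1\<close> misses only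
  the empty string, which is repaired by deleting one 0 from every output \<open>0\<^sup>k\<close>. If instead
  \<open>B\<close> has \<open>n\<close> elements, these are mapped to \<open>0\<^sup>0, \<dots>, 0\<^sup>n\<^sup>-\<^sup>1\<close>, and outputs \<open>0\<^sup>k\<close> of \<open>f\<close> become
  \<open>0\<^sup>k\<^sup>+\<^sup>n\<close>. All machines needed are compositions of machines that sweep once over the input in
  each direction and then possibly continue as another machine, chosen by the final state of the
  sweep. Functions with finite support arise by iterating the dispatch on the last digit.
\<close>

section \<open>Runs of machines\<close>

lemma funpow_Suc_apply: "(f ^^ Suc n) x = (f ^^ n) (f x)"
  by (simp add: funpow_swap1)

lemma poly_nat_mono: "poly p m \<le> poly p n" if "m \<le> n" for p :: "nat poly"
  using that by (induction p) (auto intro: add_mono mult_mono)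

lemma step_halted: "(step M ^^ t) (halt M, i, T) = (halt M, i, T)"
  by (induction t) (simp_all add: step_def)

text \<open>Halted configurations are fixed points of \<open>step\<close>, so the step count acts as
  an upper bound on the running time.\<close>

lemma computes_within_mono:
  assumes "computes_within M x y t" "t \<le> t'"
  shows "computes_within M x y t'"
proof -
  obtain d where "t' = d + t"
    using assms(2) by (metis le_add_diff_inverse2)
  then show ?thesis
    using assms(1) by (simp add: computes_within_def funpow_add step_halted)
qed

text \<open>The machines built below have sums, pairs and options as states, whereas
  \<open>poly_time_computable\<close> asks for numbers. As \<open>from_nat\<close> inverts
  \<open>to_nat\<close>, the renamed machine simulates the original step by step.\<close>

definition rename_tm :: "('q::countable) tm \<Rightarrow> nat tm" where
  "rename_tm M = \<lparr>states = to_nat ` states M, alphabet = alphabet M,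
     start = to_nat (start M), halt = to_nat (halt M),
     trans = \<lambda>q a. (case trans M (from_nat q) a of (q', b, d) \<Rightarrow> (to_nat q', b, d))\<rparr>"

lemma rename_tm_run:
  "(step (rename_tm M) ^^ t) (to_nat q, i, T) =
     (case (step M ^^ t) (q, i, T) of (q', i', T') \<Rightarrow> (to_nat q', i', T'))"
proof (induction t)
  case (Suc t)
  then show ?case
    by (auto simp: step_def rename_tm_def split: prod.splits)
qed simp

lemma wf_rename_tm:
  assumes "wf_tm M"
  shows "wf_tm (rename_tm M)"
proof -
  have "trans (rename_tm M) (to_nat q) a \<in> to_nat ` states M \<times> alphabet M \<times> UNIV"
    if "q \<in> states M" "a \<in> alphabet M" for q a
  proof -
    have "trans M q a \<in> states M \<times> alphabet M \<times> UNIV"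
      using assms that unfolding wf_tm_def by blast
    then show ?thesis
      by (auto simp: rename_tm_def)
  qed
  then show ?thesis
    using assms by (auto simp: wf_tm_def rename_tm_def)
qed

lemma poly_time_computableI:
  fixes M :: "('q::countable) tm"
  assumes "wf_tm M" "\<And>x. computes_within M x (f x) (poly p (length x))"
  shows "poly_time_computable f"
proof -
  have "computes_within (rename_tm M) x (f x) (poly p (length x))" for x
    using assms(2)[of x] rename_tm_run[of "poly p (length x)" M "start M" 0 "tape_of x"]
    by (simp add: computes_within_def rename_tm_def)
  then show ?thesis
    unfolding poly_time_computable_def using wf_rename_tm[OF assms(1)] by blast
qed

text \<open>An invariant of the runs of a well-formed machine. It ensures that a simulated machine
  only ever reads symbols of its own alphabet.\<close>

definition valid_config :: "'q tm \<Rightarrow> 'q config \<Rightarrow> bool" where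
  "valid_config M c \<longleftrightarrow> fst c \<in> states M \<and> range (snd (snd c)) \<subseteq> alphabet M"

lemma valid_config_step:
  assumes "wf_tm M" "valid_config M c"
  shows "valid_config M (step M c)"
proof -
  obtain q i T where c: "c = (q, i, T)"
    by (cases c)
  obtain q' a d where t: "trans M q (T i) = (q', a, d)"
    by (cases "trans M q (T i)")
  have "trans M q (T i) \<in> states M \<times> alphabet M \<times> UNIV"
    using assms unfolding wf_tm_def valid_config_def c by auto
  then show ?thesis
    using assms(2) t by (auto simp: c step_def valid_config_def)
qed

lemma range_tape_of: "range (tape_of x) \<subseteq> insert Blank (range Digit)"
  by (auto simp: tape_of_def)

section \<open>A controller that hands over to one of several machines\<close>

text \<open>\<open>Inl\<close> carries the working states of the controller; \<open>Inr k\<close> is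
  an exit naming the machine to continue with. Exits idle, just as halted configurations do.\<close>

definition cstep ::
    "('c \<Rightarrow> sym \<Rightarrow> ('c + 'k) \<times> sym \<times> move) \<Rightarrow> ('c + 'k) config \<Rightarrow> ('c + 'k) config" where
  "cstep \<delta> c = (case c of (s, i, T) \<Rightarrow>
     (case s of
        Inl q \<Rightarrow> (case \<delta> q (T i) of (s', a, d) \<Rightarrow> (s', shift d i, T(i := a)))
      | Inr k \<Rightarrow> c))"

lemma cstep_Inr [simp]: "cstep \<delta> (Inr k, i, T) = (Inr k, i, T)"
  by (simp add: cstep_def)

lemma cstep_run_Inr [simp]: "(cstep \<delta> ^^ t) (Inr k, i, T) = (Inr k, i, T)"
  by (induction t) simp_all

lemma cstep_changed_cells:
  "\<exists>D. finite D \<and> card D \<le> t \<and> (\<forall>j. j \<notin> D \<longrightarrow> snd (snd ((cstep \<delta> ^^ t) c)) j = snd (snd c) j)"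
proof (induction t)
  case 0
  then show ?case by (intro exI[of _ "{}"]) simp
next
  case (Suc t)
  then obtain D where D: "finite D" "card D \<le> t"
      "\<forall>j. j \<notin> D \<longrightarrow> snd (snd ((cstep \<delta> ^^ t) c)) j = snd (snd c) j"
    by blast
  obtain s i T where c: "(cstep \<delta> ^^ t) c = (s, i, T)"
    by (cases "(cstep \<delta> ^^ t) c")
  have "card (insert i D) \<le> Suc t"
    using D(1,2) by (simp add: card_insert_if)
  moreover have "snd (snd ((cstep \<delta> ^^ Suc t) c)) j = snd (snd c) j" if "j \<notin> insert i D" for j
    using D(3) that c by (auto simp: cstep_def split: sum.splits prod.splits)
  ultimately show ?case
    using D(1) by (meson finite_insert)
qed

text \<open>Every cell of the output lies in the input or is among the at most \<open>t\<close>
  cells written. This keeps the time of a subsequent machine polynomial in the length of the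
  original input.\<close>

lemma cstep_output_length:
  assumes "(cstep \<delta> ^^ t) (s, i, tape_of x) = (s', i', tape_of y)"
  shows "length y \<le> length x + t"
proof -
  obtain D where D: "finite D" "card D \<le> t" "\<forall>j. j \<notin> D \<longrightarrow> tape_of y j = tape_of x j"
    using cstep_changed_cells[of t \<delta> "(s, i, tape_of x)"] assms by auto
  have "{0..<int (length y)} \<subseteq> {0..<int (length x)} \<union> D"
  proof
    fix j assume j: "j \<in> {0..<int (length y)}"
    then have "tape_of y j \<noteq> Blank"
      by (simp add: tape_of_def)
    then show "j \<in> {0..<int (length x)} \<union> D"
      using D(3) by (auto simp: tape_of_def split: if_splits)
  qed
  then have "card {0..<int (length y)} \<le> card ({0..<int (length x)} \<union> D)"
    using D(1) by (intro card_mono) auto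
  also have "\<dots> \<le> length x + t"
    using D(2) card_Un_le[of "{0..<int (length x)}" D] by simp
  finally show ?thesis
    by simp
qed

text \<open>
  The halting states of all \<open>N k\<close> are merged into \<^const>\<open>None\<close>. Outside the alphabet of the
  currently simulated machine the transitions are irrelevant, but have to keep the combined
  machine well-formed.
\<close>

definition sub_state :: "('k \<Rightarrow> nat tm) \<Rightarrow> 'k \<Rightarrow> nat \<Rightarrow> ('c + 'k \<times> nat) option" where
  "sub_state N k q = (if q = halt (N k) then None else Some (Inr (k, q)))"

text \<open>Identifying an exit with the start of the chosen machine makes the handover free of
  cost. If that start is already halting, \<open>sub_state\<close> yields \<open>None\<close> at
  once.\<close>

definition ctrl_state :: "('k \<Rightarrow> nat tm) \<Rightarrow> 'c + 'k \<Rightarrow> ('c + 'k \<times> nat) option" where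
  "ctrl_state N s = (case s of Inl c \<Rightarrow> Some (Inl c) | Inr k \<Rightarrow> sub_state N k (start (N k)))"

definition bind_tm ::
    "'c set \<Rightarrow> sym set \<Rightarrow> 'c \<Rightarrow> ('c \<Rightarrow> sym \<Rightarrow> ('c + 'k) \<times> sym \<times> move) \<Rightarrow> ('k \<Rightarrow> nat tm)
       \<Rightarrow> ('c + 'k \<times> nat) option tm" where
  "bind_tm C \<Gamma> q\<^sub>0 \<delta> N = \<lparr>
     states = insert None (Some ` (C <+> (SIGMA k:UNIV. states (N k)))),
     alphabet = \<Gamma> \<union> (\<Union>k. alphabet (N k)),
     start = Some (Inl q\<^sub>0),
     halt = None,
     trans = \<lambda>q a. (case q of
         None \<Rightarrow> (None, a, Stay)
       | Some (Inl c) \<Rightarrow>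
           if a \<in> \<Gamma> then (case \<delta> c a of (s, b, d) \<Rightarrow> (ctrl_state N s, b, d))
           else (None, a, Stay)
       | Some (Inr (k, q)) \<Rightarrow>
           if a \<in> alphabet (N k) then (case trans (N k) q a of (q', b, d) \<Rightarrow> (sub_state N k q', b, d))
           else (None, a, Stay))\<rparr>"

text \<open>Validity lets the scanned symbol pass the alphabet guard of \<open>bind_tm\<close>; if
  \<open>q\<close> is halting, both sides stand still.\<close>

lemma bind_tm_sub_step:
  assumes "valid_config (N k) (q, i, T)"
  shows "step (bind_tm C \<Gamma> q\<^sub>0 \<delta> N) (sub_state N k q, i, T) =
           (case step (N k) (q, i, T) of (q', i', T') \<Rightarrow> (sub_state N k q', i', T'))"
  using assms
  by (auto simp: step_def bind_tm_def sub_state_def valid_config_def image_subset_iff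
      split: prod.splits)

lemma bind_tm_sub_run:
  assumes "wf_tm (N k)" "valid_config (N k) c"
  shows "(step (bind_tm C \<Gamma> q\<^sub>0 \<delta> N) ^^ t) (case c of (q, i, T) \<Rightarrow> (sub_state N k q, i, T)) =
           (case (step (N k) ^^ t) c of (q', i', T') \<Rightarrow> (sub_state N k q', i', T'))"
  using assms(2)
proof (induction t arbitrary: c)
  case (Suc t)
  obtain q i T where c: "c = (q, i, T)"
    by (cases c)
  have "(step (bind_tm C \<Gamma> q\<^sub>0 \<delta> N) ^^ Suc t) (case c of (q, i, T) \<Rightarrow> (sub_state N k q, i, T)) =
        (step (bind_tm C \<Gamma> q\<^sub>0 \<delta> N) ^^ t)
          (case step (N k) c of (q', i', T') \<Rightarrow> (sub_state N k q', i', T'))"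
    using bind_tm_sub_step[of N k q i T C \<Gamma> q\<^sub>0 \<delta>] Suc.prems
    by (simp add: c funpow_Suc_apply del: funpow.simps)
  also have "\<dots> = (case (step (N k) ^^ t) (step (N k) c) of (q', i', T') \<Rightarrow> (sub_state N k q', i', T'))"
    by (rule Suc.IH[OF valid_config_step[OF assms(1) Suc.prems]])
  finally show ?case
    by (simp only: funpow_Suc_apply)
qed simp

text \<open>The bound \<open>t' \<le> t\<close> cannot be sharpened to equality:
  \<open>cstep\<close> idles at an exit, while the combined machine would already run on as
  \<open>N k\<close>. The run is therefore cut off when the exit is reached.\<close>

lemma bind_tm_ctrl_run:
  assumes \<delta>: "\<And>c a. c \<in> C \<Longrightarrow> a \<in> \<Gamma> \<Longrightarrow> \<delta> c a \<in> (C <+> UNIV) \<times> \<Gamma> \<times> UNIV"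
    and "s \<in> C <+> UNIV" "range T \<subseteq> \<Gamma>"
    and "(cstep \<delta> ^^ t) (s, i, T) = (Inr k, i', T')"
  shows "\<exists>t'\<le>t. (step (bind_tm C \<Gamma> q\<^sub>0 \<delta> N) ^^ t') (ctrl_state N s, i, T) =
                (ctrl_state N (Inr k), i', T')"
  using assms(2-)
proof (induction t arbitrary: s i T)
  case 0
  then show ?case by simp
next
  case (Suc t)
  show ?case
  proof (cases s)
    case (Inr k')
    then show ?thesis
      using Suc.prems(3) by (intro exI[of _ 0]) (simp del: funpow.simps)
  next
    case (Inl c)
    obtain s1 a d where e: "\<delta> c (T i) = (s1, a, d)"
      by (cases "\<delta> c (T i)")
    have m: "c \<in> C" "T i \<in> \<Gamma>"
      using Suc.prems(1,2) Inl by auto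
    have s1: "s1 \<in> C <+> UNIV" "a \<in> \<Gamma>"
      using \<delta>[OF m] e by auto
    have "cstep \<delta> (s, i, T) = (s1, shift d i, T(i := a))"
      using e Inl by (simp add: cstep_def)
    then have "(cstep \<delta> ^^ t) (s1, shift d i, T(i := a)) = (Inr k, i', T')"
      using Suc.prems(3) by (simp only: funpow_Suc_apply)
    moreover have "range (T(i := a)) \<subseteq> \<Gamma>"
      using Suc.prems(2) s1(2) by auto
    ultimately obtain t' where t': "t' \<le> t"
        "(step (bind_tm C \<Gamma> q\<^sub>0 \<delta> N) ^^ t') (ctrl_state N s1, shift d i, T(i := a)) =
           (ctrl_state N (Inr k), i', T')"
      using Suc.IH[OF s1(1)] by blast
    have "step (bind_tm C \<Gamma> q\<^sub>0 \<delta> N) (ctrl_state N s, i, T) =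
            (ctrl_state N s1, shift d i, T(i := a))"
      using m e Inl by (simp add: step_def bind_tm_def ctrl_state_def)
    then show ?thesis
      using t' by (intro exI[of _ "Suc t'"]) (simp add: funpow_Suc_apply del: funpow.simps)
  qed
qed

text \<open>Finitely many exits keep the combined states and symbols finite. A symbol foreign to the
  active component leads to \<open>None\<close>, so transitions stay inside the machine.\<close>

lemma wf_bind_tm:
  fixes N :: "'k::finite \<Rightarrow> nat tm"
  assumes "finite C" "finite \<Gamma>" "insert Blank (range Digit) \<subseteq> \<Gamma>" "q\<^sub>0 \<in> C"
    and \<delta>: "\<And>c a. c \<in> C \<Longrightarrow> a \<in> \<Gamma> \<Longrightarrow> \<delta> c a \<in> (C <+> UNIV) \<times> \<Gamma> \<times> UNIV"
    and N: "\<And>k. wf_tm (N k)"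
  shows "wf_tm (bind_tm C \<Gamma> q\<^sub>0 \<delta> N)"
proof -
  let ?M = "bind_tm C \<Gamma> q\<^sub>0 \<delta> N"
  have sub: "sub_state N k q \<in> states ?M" if "q \<in> states (N k)" for k q
    using that by (auto simp: sub_state_def bind_tm_def)
  have ctrl: "ctrl_state N s \<in> states ?M" if "s \<in> C <+> UNIV" for s
    using that sub N unfolding ctrl_state_def wf_tm_def
    by (auto split: sum.splits) (auto simp: bind_tm_def)
  have "trans ?M q a \<in> states ?M \<times> alphabet ?M \<times> UNIV" if q: "q \<in> states ?M" and a: "a \<in> alphabet ?M" for q a
  proof -
    consider "q = None" | c where "q = Some (Inl c)" "c \<in> C"
      | k p where "q = Some (Inr (k, p))" "p \<in> states (N k)"
      using q by (auto simp: bind_tm_def)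
    then show ?thesis
    proof cases
      case 1
      then show ?thesis using a by (simp add: bind_tm_def)
    next
      case 2
      show ?thesis
      proof (cases "a \<in> \<Gamma>")
        case True
        obtain s b d where e: "\<delta> c a = (s, b, d)" by (cases "\<delta> c a")
        then have "s \<in> C <+> UNIV" "b \<in> \<Gamma>"
          using \<delta>[OF 2(2) True] by auto
        then show ?thesis
          using ctrl[of s] 2 True e by (simp add: bind_tm_def)
      next
        case False
        then show ?thesis using 2 a by (simp add: bind_tm_def)
      qed
    next
      case 3
      show ?thesis
      proof (cases "a \<in> alphabet (N k)")
        case True
        obtain s b d where e: "trans (N k) p a = (s, b, d)" by (cases "trans (N k) p a")
        have "trans (N k) p a \<in> states (N k) \<times> alphabet (N k) \<times> UNIV"
          using N[of k] 3(2) True unfolding wf_tm_def by blast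
        then have "s \<in> states (N k)" "b \<in> alphabet (N k)"
          using e by auto
        then show ?thesis
          using sub[of s k] 3 True e by (auto simp: bind_tm_def)
      next
        case False
        then show ?thesis using 3 a by (simp add: bind_tm_def)
      qed
    qed
  qed
  moreover have "finite (states ?M)" "finite (alphabet ?M)"
    using assms(1,2) N by (auto simp: bind_tm_def wf_tm_def)
  moreover have "insert Blank (range Digit) \<subseteq> alphabet ?M" "start ?M \<in> states ?M" "halt ?M \<in> states ?M"
    using assms(3,4) by (auto simp: bind_tm_def)
  ultimately show ?thesis
    unfolding wf_tm_def by blast
qed

text \<open>The general closure principle: a polynomial-time controller computes an intermediate
  string \<open>y x\<close> and selects by \<open>k x\<close> one of finitely many polynomial-time
  functions to apply to it.\<close>

lemma poly_time_bind:
  fixes \<delta> :: "'c::countable \<Rightarrow> sym \<Rightarrow> ('c + 'k::finite) \<times> sym \<times> move"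
    and p :: "nat poly"
  assumes ctrl: "finite C" "finite \<Gamma>" "insert Blank (range Digit) \<subseteq> \<Gamma>" "q\<^sub>0 \<in> C"
      "\<And>c a. c \<in> C \<Longrightarrow> a \<in> \<Gamma> \<Longrightarrow> \<delta> c a \<in> (C <+> UNIV) \<times> \<Gamma> \<times> UNIV"
    and run: "\<And>x. (cstep \<delta> ^^ poly p (length x)) (Inl q\<^sub>0, 0, tape_of x) = (Inr (k x), 0, tape_of (y x))"
    and g: "\<And>k. poly_time_computable (g k)"
  shows "poly_time_computable (\<lambda>x. g (k x) (y x))"
proof -
  have "\<forall>k. \<exists>(M :: nat tm) r. wf_tm M \<and> (\<forall>x. computes_within M x (g k x) (poly r (length x)))"
    using g by (simp add: poly_time_computable_def)
  then obtain N :: "'k \<Rightarrow> nat tm" and r :: "'k \<Rightarrow> nat poly"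
    where N: "\<And>k. wf_tm (N k)"
      and r: "\<And>k x. computes_within (N k) x (g k x) (poly (r k) (length x))"
    by metis
  let ?M = "bind_tm C \<Gamma> q\<^sub>0 \<delta> N"
  \<comment> \<open>\<open>[:0, 1:]\<close> is the identity polynomial, so
    \<open>p + [:0, 1:]\<close> bounds the length of \<open>y x\<close>. Summing over all
    \<open>k\<close> gives one bound whichever machine is chosen.\<close>
  define P where "P = p + (\<Sum>k\<in>UNIV. pcompose (r k) (p + [:0, 1:]))"
  have "computes_within ?M x (g (k x) (y x)) (poly P (length x))" for x
  proof -
    let ?k = "k x" and ?y = "y x"
    let ?u = "poly (r ?k) (length ?y)"
    obtain t where t: "t \<le> poly p (length x)"
        "(step ?M ^^ t) (ctrl_state N (Inl q\<^sub>0), 0, tape_of x) = (ctrl_state N (Inr ?k), 0, tape_of ?y)"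
      using bind_tm_ctrl_run[OF ctrl(5) _ _ run[of x], where N = N and q\<^sub>0 = q\<^sub>0] ctrl(3,4) range_tape_of[of x]
      by blast
    have "valid_config (N ?k) (start (N ?k), 0, tape_of ?y)"
      using N[of ?k] subset_trans[OF range_tape_of[of ?y]] by (simp add: valid_config_def wf_tm_def)
    from bind_tm_sub_run[where t = ?u and N = N and k = ?k and C = C and \<Gamma> = \<Gamma> and q\<^sub>0 = q\<^sub>0 and \<delta> = \<delta>, OF N this]
    have "(step ?M ^^ ?u) (ctrl_state N (Inr ?k), 0, tape_of ?y) = (None, 0, tape_of (g ?k ?y))"
      using r[of ?k ?y] by (simp add: computes_within_def ctrl_state_def sub_state_def)
    then have "(step ?M ^^ (?u + t)) (ctrl_state N (Inl q\<^sub>0), 0, tape_of x) = (None, 0, tape_of (g ?k ?y))"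
      using t(2) by (simp add: funpow_add)
    then have "computes_within ?M x (g ?k ?y) (?u + t)"
      by (simp add: computes_within_def ctrl_state_def bind_tm_def)
    moreover have "?u + t \<le> poly P (length x)"
    proof -
      have "?u \<le> poly (r ?k) (poly p (length x) + length x)"
        using cstep_output_length[OF run[of x]] by (intro poly_nat_mono) simp
      also have "\<dots> \<le> (\<Sum>k\<in>UNIV. poly (r k) (poly p (length x) + length x))"
        by (rule member_le_sum) auto
      finally show ?thesis
        using t(1) by (simp add: P_def poly_sum poly_pcompose)
    qed
    ultimately show ?thesis
      by (rule computes_within_mono)
  qed
  with wf_bind_tm[OF ctrl N] show ?thesis
    by (rule poly_time_computableI)
qed

section \<open>Composition and identity\<close>

text \<open>A machine for \<open>f\<close> becomes a controller with a single exit, at which a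
  machine for \<open>g\<close> takes over.\<close>

lemma poly_time_comp:
  assumes "poly_time_computable f" "poly_time_computable g"
  shows "poly_time_computable (\<lambda>x. g (f x))"
proof -
  obtain M :: "nat tm" and p :: "nat poly"
    where M: "wf_tm M" "\<And>x. computes_within M x (f x) (poly p (length x))"
    using assms(1) by (auto simp: poly_time_computable_def)
  define \<delta> :: "nat \<Rightarrow> sym \<Rightarrow> (nat + unit) \<times> sym \<times> move" where
    "\<delta> q a = (if q = halt M then (Inr (), a, Stay)
              else (case trans M q a of (q', b, d) \<Rightarrow> (Inl q', b, d)))" for q a
  \<comment> \<open>Passing from the halting state to the exit costs one extra step, hence
    \<open>p + 1\<close> below.\<close>
  have run: "(cstep \<delta> ^^ Suc t) (Inl q, i, T) = (Inr (), i', T')"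
    if "(step M ^^ t) (q, i, T) = (halt M, i', T')" for t q i T i' T'
    using that
  proof (induction t arbitrary: q i T)
    case 0
    then show ?case by (simp add: cstep_def \<delta>_def)
  next
    case (Suc t)
    show ?case
    proof (cases "q = halt M")
      case True
      then have "i' = i" "T' = T"
        using Suc.prems step_halted[of "Suc t" M i T] by (simp_all del: funpow.simps)
      moreover have "cstep \<delta> (Inl q, i, T) = (Inr (), i, T)"
        using True by (simp add: cstep_def \<delta>_def)
      ultimately show ?thesis
        by (simp add: funpow_Suc_apply del: funpow.simps)
    next
      case False
      obtain q1 a d where e: "trans M q (T i) = (q1, a, d)"
        by (cases "trans M q (T i)")
      have "step M (q, i, T) = (q1, shift d i, T(i := a))"
        using False e by (simp add: step_def)
      then have "(step M ^^ t) (q1, shift d i, T(i := a)) = (halt M, i', T')"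
        using Suc.prems by (simp only: funpow_Suc_apply)
      from Suc.IH[OF this]
      moreover have "cstep \<delta> (Inl q, i, T) = (Inl q1, shift d i, T(i := a))"
        using False e by (simp add: cstep_def \<delta>_def)
      ultimately show ?thesis
        by (simp only: funpow_Suc_apply[of "Suc t"])
    qed
  qed
  show ?thesis
  proof (rule poly_time_bind[where g = "\<lambda>_. g" and k = "\<lambda>_. ()" and C = "states M"
        and \<Gamma> = "alphabet M" and q\<^sub>0 = "start M" and \<delta> = \<delta> and p = "p + 1"])
    show "\<delta> c a \<in> (states M <+> UNIV) \<times> alphabet M \<times> UNIV"
      if "c \<in> states M" "a \<in> alphabet M" for c a
    proof -
      have "trans M c a \<in> states M \<times> alphabet M \<times> UNIV"
        using M(1) that unfolding wf_tm_def by blast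
      then show ?thesis
        using that(2) by (auto simp: \<delta>_def split: prod.splits)
    qed
    show "(cstep \<delta> ^^ poly (p + 1) (length x)) (Inl (start M), 0, tape_of x) = (Inr (), 0, tape_of (f x))" for x
      using run M(2)[of x] by (simp add: computes_within_def del: funpow.simps(2))
  qed (use M(1) assms(2) in \<open>auto simp: wf_tm_def\<close>)
qed

lemma poly_time_id: "poly_time_computable (\<lambda>x. x)"
proof (rule poly_time_computableI)
  let ?M = "\<lparr>states = {0}, alphabet = insert Blank (range Digit), start = 0, halt = 0,
     trans = \<lambda>q a. (0, a, Stay)\<rparr> :: nat tm"
  show "wf_tm ?M"
    by (simp add: wf_tm_def)
  show "computes_within ?M x x (poly 0 (length x))" for x
    by (simp add: computes_within_def)
qed

section \<open>Machines that sweep over the input once in each direction\<close>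

fun cell :: "bool option \<Rightarrow> sym" where
  "cell None = Blank"
| "cell (Some b) = Digit b"

text \<open>Extends \<open>tape_of\<close> to tapes with erased cells, marked \<open>None\<close>.
  Different lists can denote the same tape, as trailing blanks are invisible.\<close>

definition cells :: "bool option list \<Rightarrow> int \<Rightarrow> sym" where
  "cells zs i = (if 0 \<le> i \<and> i < int (length zs) then cell (zs ! nat i) else Blank)"

lemma cells_map_Some: "cells (map Some x) = tape_of x"
  by (auto simp: cells_def tape_of_def fun_eq_iff)

lemma cells_snoc_None: "cells (zs @ [None]) = cells zs"
  by (auto simp: cells_def fun_eq_iff nth_append not_less)

lemma cells_replicate_None: "cells (replicate n None) = tape_of []"
  by (auto simp: cells_def tape_of_def fun_eq_iff)

lemma cells_at: "cells (us @ z # zs) (int (length us)) = cell z"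
  by (simp add: cells_def)

lemma cells_upd: "(cells (us @ z # zs))(int (length us) := cell z') = cells (us @ z' # zs)"
  by (auto simp: cells_def fun_eq_iff nth_append nth_Cons' nat_eq_iff)

lemma tape_of_upd_end: "(tape_of x)(int (length x) := cell z) = cells (map Some x @ [z])"
  by (auto simp: cells_def tape_of_def fun_eq_iff nth_append)

text \<open>The pass to the right only reads, folding \<open>\<rho>\<close>. At the blank after the
  input, \<open>\<tau>\<close> picks the initial state of the pass to the left and the content of
  that cell; \<open>\<mu>\<close> then rewrites the digits. The blank before the input turns the
  head back to cell 0 and makes the current state the exit.\<close>

fun sweep ::
    "('r \<Rightarrow> bool \<Rightarrow> 'r) \<Rightarrow> ('r \<Rightarrow> 'l \<times> bool option) \<Rightarrow> ('l \<Rightarrow> bool \<Rightarrow> 'l \<times> bool option)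
       \<Rightarrow> 'r + 'l \<Rightarrow> sym \<Rightarrow> (('r + 'l) + 'l) \<times> sym \<times> move" where
  "sweep \<rho> \<tau> \<mu> (Inl r) (Digit b) = (Inl (Inl (\<rho> r b)), Digit b, Right)"
| "sweep \<rho> \<tau> \<mu> (Inl r) Blank = (case \<tau> r of (l, z) \<Rightarrow> (Inl (Inr l), cell z, Left))"
| "sweep \<rho> \<tau> \<mu> (Inr l) (Digit b) = (case \<mu> l b of (l', z) \<Rightarrow> (Inl (Inr l'), cell z, Left))"
| "sweep \<rho> \<tau> \<mu> (Inr l) Blank = (Inr l, Blank, Right)"
| "sweep \<rho> \<tau> \<mu> c (Aux n) = (Inl c, Aux n, Stay)"

text \<open>The list argument is the unread part of the input, last digit first.\<close>

fun retrace ::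
    "('l \<Rightarrow> bool \<Rightarrow> 'l \<times> bool option) \<Rightarrow> 'l \<Rightarrow> bool list \<Rightarrow> bool option list \<Rightarrow> 'l \<times> bool option list"
  where
  "retrace \<mu> l [] zs = (l, zs)"
| "retrace \<mu> l (b # bs) zs = (case \<mu> l b of (l', z) \<Rightarrow> retrace \<mu> l' bs (z # zs))"

lemma sweep_right:
  "(cstep (sweep \<rho> \<tau> \<mu>) ^^ length v) (Inl (Inl r), int (length u), tape_of (u @ v)) =
     (Inl (Inl (foldl \<rho> r v)), int (length (u @ v)), tape_of (u @ v))"
proof (induction v arbitrary: u r)
  case (Cons b v)
  have b: "tape_of (u @ b # v) (int (length u)) = Digit b"
    by (simp add: tape_of_def)
  then have "cstep (sweep \<rho> \<tau> \<mu>) (Inl (Inl r), int (length u), tape_of (u @ b # v)) =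
      (Inl (Inl (\<rho> r b)), int (length (u @ [b])), tape_of ((u @ [b]) @ v))"
    by (simp add: cstep_def fun_upd_idem)
  then show ?case
    using Cons.IH[of "\<rho> r b" "u @ [b]"]
    by (simp add: funpow_Suc_apply del: funpow.simps)
qed simp

text \<open>\<open>zs\<close> is the part already rewritten. The additional step is the exit at cell
  -1, which returns the head to cell 0.\<close>

lemma sweep_left:
  "(cstep (sweep \<rho> \<tau> \<mu>) ^^ Suc (length v)) (Inl (Inr l), int (length v) - 1, cells (map Some (rev v) @ zs)) =
     (case retrace \<mu> l v zs of (l', ys) \<Rightarrow> (Inr l', 0, cells ys))"
proof (induction v arbitrary: l zs)
  case Nil
  have "cells zs (-1) = Blank"
    by (simp add: cells_def)
  then show ?case
    by (simp add: cstep_def fun_upd_idem)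
next
  case (Cons b v)
  obtain l' z where e: "\<mu> l b = (l', z)"
    by (cases "\<mu> l b")
  let ?us = "map Some (rev v)"
  have "cells (?us @ Some b # zs) (int (length v)) = Digit b"
    using cells_at[of ?us "Some b" zs] by simp
  moreover have "(cells (?us @ Some b # zs))(int (length v) := cell z) = cells (?us @ z # zs)"
    using cells_upd[of ?us "Some b" zs z] by simp
  ultimately have "cstep (sweep \<rho> \<tau> \<mu>) (Inl (Inr l), int (length (b # v)) - 1, cells (map Some (rev (b # v)) @ zs)) =
      (Inl (Inr l'), int (length v) - 1, cells (?us @ z # zs))"
    using e by (simp add: cstep_def)
  then have "(cstep (sweep \<rho> \<tau> \<mu>) ^^ Suc (length (b # v)))
        (Inl (Inr l), int (length (b # v)) - 1, cells (map Some (rev (b # v)) @ zs)) =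
      (cstep (sweep \<rho> \<tau> \<mu>) ^^ length (b # v)) (Inl (Inr l'), int (length v) - 1, cells (?us @ z # zs))"
    by (simp only: funpow_Suc_apply)
  then show ?case
    using Cons.IH[of l' "z # zs"] e by (simp del: funpow.simps)
qed

text \<open>An instance of \<open>poly_time_bind\<close> in which the final state of the sweep
  selects the function. The list \<open>zs\<close> is compared with \<open>y x\<close> only as a
  tape, because erasing digits leaves trailing blanks.\<close>

lemma poly_time_sweep:
  fixes \<rho> :: "'r::finite \<Rightarrow> bool \<Rightarrow> 'r" and \<mu> :: "'l::finite \<Rightarrow> bool \<Rightarrow> 'l \<times> bool option"
  assumes out: "\<And>x l z. \<tau> (foldl \<rho> r x) = (l, z) \<Longrightarrow>
      \<exists>zs. retrace \<mu> l (rev x) [z] = (k x, zs) \<and> cells zs = tape_of (y x)"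
    and g: "\<And>l. poly_time_computable (g l)"
  shows "poly_time_computable (\<lambda>x. g (k x) (y x))"
proof (rule poly_time_bind[where \<delta> = "sweep \<rho> \<tau> \<mu>" and C = UNIV
      and \<Gamma> = "insert Blank (range Digit)" and q\<^sub>0 = "Inl r" and p = "[:2, 2:]", OF _ _ _ _ _ _ g])
  have cell: "cell z \<in> insert Blank (range Digit)" for z
    by (cases z) auto
  show "sweep \<rho> \<tau> \<mu> c a \<in> (UNIV <+> UNIV) \<times> insert Blank (range Digit) \<times> UNIV"
    if "a \<in> insert Blank (range Digit)" for c a
    using that cell by (cases c) (auto split: prod.splits)
  show "(cstep (sweep \<rho> \<tau> \<mu>) ^^ poly [:2, 2:] (length x)) (Inl (Inl r), 0, tape_of x) =
      (Inr (k x), 0, tape_of (y x))" for x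
  proof -
    let ?n = "length x" and ?S = "cstep (sweep \<rho> \<tau> \<mu>)"
    obtain l z where e: "\<tau> (foldl \<rho> r x) = (l, z)"
      by (cases "\<tau> (foldl \<rho> r x)")
    obtain zs where zs: "retrace \<mu> l (rev x) [z] = (k x, zs)" "cells zs = tape_of (y x)"
      using out[OF e] by blast
    have "tape_of x (int ?n) = Blank"
      by (simp add: tape_of_def)
    then have turn: "?S (Inl (Inl (foldl \<rho> r x)), int ?n, tape_of x) =
        (Inl (Inr l), int ?n - 1, cells (map Some x @ [z]))"
      using e by (simp add: cstep_def tape_of_upd_end)
    \<comment> \<open>The input is read in \<open>?n\<close> steps, the turn takes one, and the way
      back including the exit takes \<open>Suc ?n\<close>.\<close>
    have "poly [:2, 2:] ?n = Suc ?n + Suc ?n"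
      by simp
    then have "(?S ^^ poly [:2, 2:] ?n) (Inl (Inl r), 0, tape_of x) =
        (?S ^^ Suc ?n) (?S ((?S ^^ ?n) (Inl (Inl r), 0, tape_of x)))"
      by (simp only: funpow_add funpow.simps o_apply)
    also have "(?S ^^ ?n) (Inl (Inl r), 0, tape_of x) = (Inl (Inl (foldl \<rho> r x)), int ?n, tape_of x)"
      using sweep_right[where u = "[]" and v = x and r = r] by simp
    also note turn
    also have "(?S ^^ Suc ?n) (Inl (Inr l), int ?n - 1, cells (map Some x @ [z])) =
        (Inr (k x), 0, tape_of (y x))"
      using sweep_left[where \<rho> = \<rho> and \<tau> = \<tau> and \<mu> = \<mu> and v = "rev x" and l = l and zs = "[z]"] zs
      by (simp del: funpow.simps)
    finally show ?thesis .
  qed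
qed simp_all

section \<open>Functions computed by a single sweep\<close>

lemma foldl_disj: "foldl (\<or>) s x \<longleftrightarrow> s \<or> True \<in> set x"
  by (induction x arbitrary: s) auto

lemma retrace_copy:
  assumes "\<And>b. \<mu> l b = (l, Some b)"
  shows "retrace \<mu> l v zs = (l, map Some (rev v) @ zs)"
  by (induction v arbitrary: zs) (simp_all add: assms)

text \<open>The pass to the right remembers whether a 1 has occurred, which decides what the cell
  after the input receives; the pass to the left merely copies. Both adjustments of zero blocks
  below have this form.\<close>

lemma poly_time_append_bit:
  "poly_time_computable (\<lambda>x. x @ (case \<sigma> (True \<in> set x) of None \<Rightarrow> [] | Some b \<Rightarrow> [b]))"
proof (rule poly_time_sweep[where \<rho> = "(\<or>)" and r = False and \<tau> = "\<lambda>s. ((), \<sigma> s)"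
      and \<mu> = "\<lambda>l b. (l, Some b)" and g = "\<lambda>_ x. x" and k = "\<lambda>_. ()"])
  fix x l z
  assume "((), \<sigma> (foldl (\<or>) False x)) = (l, z)"
  then have z: "z = \<sigma> (True \<in> set x)"
    by (simp add: foldl_disj)
  have "cells (map Some x @ [z]) = tape_of (x @ (case z of None \<Rightarrow> [] | Some b \<Rightarrow> [b]))"
    using cells_map_Some[of "x @ [the z]"]
    by (cases z) (simp_all add: cells_snoc_None cells_map_Some)
  then show "\<exists>zs. retrace (\<lambda>l b. (l, Some b)) l (rev x) [z] = ((), zs) \<and>
      cells zs = tape_of (x @ (case \<sigma> (True \<in> set x) of None \<Rightarrow> [] | Some b \<Rightarrow> [b]))"
    by (simp add: retrace_copy z)
qed (rule poly_time_id)

lemma poly_time_append_const: "poly_time_computable (\<lambda>x. x @ [b])"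
  using poly_time_append_bit[of "\<lambda>_. Some b"] by simp

lemma poly_time_const_Nil: "poly_time_computable (\<lambda>_. [])"
proof (rule poly_time_sweep[where \<rho> = "\<lambda>_ _. ()" and r = "()" and \<tau> = "\<lambda>_. ((), None)"
      and \<mu> = "\<lambda>_ _. ((), None)" and g = "\<lambda>_ x. x" and k = "\<lambda>_. ()" and y = "\<lambda>_. []"])
  have retrace: "retrace (\<lambda>_ _. ((), None)) () v (replicate n None) = ((), replicate (length v + n) None)"
    for v n
  proof (induction v arbitrary: n)
    case (Cons b v)
    then show ?case
      using Cons.IH[of "Suc n"] by simp
  qed simp
  fix x l z
  assume "((), None) = (l :: unit, z :: bool option)"
  then show "\<exists>zs. retrace (\<lambda>_ _. ((), None)) l (rev x) [z] = ((), zs) \<and> cells zs = tape_of []"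
    using retrace[of "rev x" 1] cells_replicate_None[of "Suc (length x)"] by auto
qed (rule poly_time_id)

lemma poly_time_const: "poly_time_computable (\<lambda>_. e)"
proof (induction e rule: rev_induct)
  case Nil
  show ?case by (rule poly_time_const_Nil)
next
  case (snoc b e)
  show ?case by (rule poly_time_comp[OF snoc poly_time_append_const])
qed

text \<open>State \<open>None\<close> means that the pass to the left has met no digit yet. The
  first one met is the last digit of the input: it is erased and kept as the exit, and all others
  are copied.\<close>

lemma poly_time_dispatch:
  assumes "\<And>k. poly_time_computable (g k)"
  shows "poly_time_computable
    (\<lambda>x. g (if x = [] then None else Some (last x)) (butlast x))"
proof (rule poly_time_sweep[where \<rho> = "\<lambda>_ _. ()" and r = "()" and \<tau> = "\<lambda>_. (None, None)"
      and \<mu> = "\<lambda>l b. case l of None \<Rightarrow> (Some b, None) | Some c \<Rightarrow> (Some c, Some b)"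
      and g = g and k = "\<lambda>x. if x = [] then None else Some (last x)" and y = butlast, OF _ assms])
  let ?\<mu> = "\<lambda>l b. case l of None \<Rightarrow> (Some b, None) | Some c \<Rightarrow> (Some c, Some b)"
  fix x :: "bool list" and l z :: "bool option"
  assume "(None, None) = (l, z)"
  moreover have "\<exists>zs. retrace ?\<mu> None (rev x) [None] = (if x = [] then None else Some (last x), zs) \<and>
      cells zs = tape_of (butlast x)"
  proof (cases x rule: rev_cases)
    case Nil
    then show ?thesis
      using cells_replicate_None[of 1] by simp
  next
    case (snoc u b)
    \<comment> \<open>One \<open>None\<close> is the erased last digit, the other the blank cell
      after the input.\<close>
    have "cells (map Some u @ [None, None]) = tape_of u"
      using cells_snoc_None[of "map Some u @ [None]"] cells_snoc_None[of "map Some u"]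
      by (simp add: cells_map_Some)
    then show ?thesis
      by (simp add: snoc retrace_copy)
  qed
  ultimately show "\<exists>zs. retrace ?\<mu> l (rev x) [z] = (if x = [] then None else Some (last x), zs) \<and>
      cells zs = tape_of (butlast x)"
    by simp
qed

section \<open>Case distinction on the last digit\<close>

definition by_last :: "(bool \<Rightarrow> bool list \<Rightarrow> bool list) \<Rightarrow> bool list \<Rightarrow> bool list \<Rightarrow> bool list" where
  "by_last F e x = (if x = [] then e else F (last x) (butlast x))"

lemma by_last_simps [simp]:
  "by_last F e [] = e" "by_last F e (x @ [b]) = F b x"
  by (simp_all add: by_last_def)

lemma poly_time_by_last:
  assumes "\<And>b. poly_time_computable (F b)"
  shows "poly_time_computable (by_last F e)"
proof -
  have "poly_time_computable (case k of None \<Rightarrow> \<lambda>_. e | Some b \<Rightarrow> F b)" for k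
    using assms poly_time_const by (cases k) auto
  from poly_time_dispatch[of "\<lambda>k. case k of None \<Rightarrow> \<lambda>_. e | Some b \<Rightarrow> F b", OF this]
  show ?thesis
    by (rule back_subst[where P = poly_time_computable]) (auto simp: by_last_def fun_eq_iff)
qed

text \<open>Induction on a strict bound \<open>n\<close> for the lengths in the support: fixing the
  last digit of the argument leaves two functions with bound one smaller, which
  \<open>by_last\<close> reassembles.\<close>

lemma poly_time_finite_support:
  assumes "finite {x. F x \<noteq> []}"
  shows "poly_time_computable F"
proof -
  have "poly_time_computable F" if "\<And>x. n \<le> length x \<Longrightarrow> F x = []" for n F
    using that
  proof (induction n arbitrary: F)
    case 0
    then have "F = (\<lambda>_. [])"
      by auto
    then show ?case
      using poly_time_const_Nil by simp
  next
    case (Suc n)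
    have "poly_time_computable (\<lambda>x. F (x @ [b]))" for b
      by (rule Suc.IH) (simp add: Suc.prems)
    then have "poly_time_computable (by_last (\<lambda>b x. F (x @ [b])) (F []))"
      by (rule poly_time_by_last)
    moreover have "by_last (\<lambda>b x. F (x @ [b])) (F []) = F"
      by (auto simp: by_last_def fun_eq_iff)
    ultimately show ?case
      by simp
  qed
  moreover obtain n where "\<forall>x\<in>{x. F x \<noteq> []}. length x \<le> n"
    using assms finite_maxlen finite_nat_set_iff_bounded_le by (metis finite_imageI imageI)
  then have "F x = []" if "Suc n \<le> length x" for x
    using that by force
  ultimately show ?thesis
    by blast
qed

section \<open>Compression of joins\<close>

text \<open>The range of the restricted map is the image of \<open>A\<close>. Phrased as a
  bijection, compression can be composed and glued.\<close>

lemma P_compressible_iff: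
  "P_compressible A \<longleftrightarrow> (\<exists>f. poly_time_computable f \<and> bij_betw f A UNIV)"
proof -
  have "ran ((\<lambda>x. Some (f x)) |` A) = f ` A" for f :: "bool list \<Rightarrow> bool list"
    by (auto simp: ran_def restrict_map_def)
  then show ?thesis
    by (simp add: P_compressible_def compression_function_def bij_betw_def conj_commute inj_on_def dom_def)
qed

text \<open>The join consists of disjoint copies of \<open>A\<close> and \<open>B\<close>, and their
  images \<open>U\<close> and \<open>- U\<close> partition all strings, so the two bijections can be
  glued.\<close>

lemma bij_betw_by_last:
  assumes "bij_betw (F False) A U" "bij_betw (F True) B (- U)"
  shows "bij_betw (by_last F e) (A \<oplus> B) UNIV"
proof -
  have snoc: "bij_betw (\<lambda>x. x @ [b]) C ((\<lambda>x. x @ [b]) ` C)" for b :: bool and C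
    by (auto simp: bij_betw_def inj_on_def)
  have part: "bij_betw (by_last F e) ((\<lambda>x. x @ [b]) ` C) V" if "bij_betw (F b) C V" for b C V
    using that by (auto simp: bij_betw_def inj_on_def image_image)
  have "A \<oplus> B = (\<lambda>x. x @ [False]) ` A \<union> (\<lambda>x. x @ [True]) ` B"
    by (auto simp: join_def)
  then show ?thesis
    using bij_betw_combine[OF part part, OF assms] by simp
qed

lemma P_compressible_joinI:
  assumes "\<And>b. poly_time_computable (F b)"
    and "bij_betw (F False) A U" "bij_betw (F True) B (- U)"
  shows "P_compressible (A \<oplus> B)"
  using poly_time_by_last[of F, OF assms(1)] bij_betw_by_last[of F, OF assms(2,3)]
  unfolding P_compressible_iff by blast

section \<open>Join of two compressible sets\<close>

lemma no_True_iff: "True \<notin> set x \<longleftrightarrow> (\<exists>n. x = replicate n False)"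
  by (metis (full_types) in_set_replicate replicate_length_same)

lemma P_compressible_join:
  assumes "P_compressible A" "P_compressible B"
  shows "P_compressible (A \<oplus> B)"
proof -
  obtain f g where f: "poly_time_computable f" "bij_betw f A UNIV"
    and g: "poly_time_computable g" "bij_betw g B UNIV"
    using assms by (auto simp: P_compressible_iff)
  \<comment> \<open>This merges appending a 0 with deleting one 0 from a zero block: strings with a
    1 are extended, zero blocks stay fixed, and so the empty string is reached.\<close>
  define \<alpha> where "\<alpha> x = x @ (case (if True \<in> set x then Some False else None) of None \<Rightarrow> [] | Some b \<Rightarrow> [b])"
    for x :: "bool list"
  let ?U = "- range (\<lambda>x. x @ [True])"
  have \<alpha>: "bij_betw \<alpha> UNIV ?U"
  proof (rule bij_betw_imageI)
    show "inj \<alpha>"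
      by (auto simp: inj_on_def \<alpha>_def split: if_splits)
    have "y \<in> range \<alpha>" if y: "y \<in> ?U" for y
    proof (cases "True \<in> set y")
      case True
      \<comment> \<open>Since \<open>y\<close> does not end in 1, its digit 1 lies in
        \<open>u\<close>, so \<open>\<alpha>\<close> does extend \<open>u\<close>.\<close>
      with y obtain u where "y = u @ [False]"
        by (cases y rule: rev_cases) auto
      then show ?thesis
        using True by (intro range_eqI[of _ _ u]) (simp add: \<alpha>_def)
    next
      case False
      then show ?thesis
        by (intro range_eqI[of _ _ y]) (simp add: \<alpha>_def)
    qed
    then show "range \<alpha> = ?U"
      by (auto simp: \<alpha>_def split: if_splits)
  qed
  have "bij_betw (\<lambda>x. x @ [True]) UNIV (- ?U)"
    by (auto simp: bij_betw_def inj_on_def)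
  moreover have "poly_time_computable (\<lambda>x. \<alpha> (f x))"
    unfolding \<alpha>_def using poly_time_comp[OF f(1) poly_time_append_bit] .
  then have "poly_time_computable (\<lambda>x. if b then g x @ [True] else \<alpha> (f x))" for b
    using poly_time_comp[OF g(1) poly_time_append_const] by (cases b) simp_all
  ultimately show ?thesis
    using bij_betw_trans[OF f(2) \<alpha>] bij_betw_trans[OF g(2)]
    by (intro P_compressible_joinI[where F = "\<lambda>b x. if b then g x @ [True] else \<alpha> (f x)" and U = ?U])
      (auto simp: o_def)
qed

section \<open>Join with a finite set\<close>

text \<open>Each round of the induction lengthens all zero blocks among the outputs by one 0, which
  vacates one further block. As \<open>n\<close> is fixed, only finitely many compositions
  occur.\<close>

lemma poly_time_free_zeros:
  assumes "poly_time_computable f" "bij_betw f A UNIV"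
  shows "\<exists>f'. poly_time_computable f' \<and> bij_betw f' A (- ((\<lambda>i. replicate i False) ` {..<n}))"
proof (induction n)
  case 0
  then show ?case using assms by auto
next
  case (Suc n)
  let ?Z = "\<lambda>n. (\<lambda>i. replicate i False) ` {..<n}"
  obtain f' where f': "poly_time_computable f'" "bij_betw f' A (- ?Z n)"
    using Suc by blast
  \<comment> \<open>Now only zero blocks grow, while strings with a 1 stay fixed; blocks of length
    at least \<open>n\<close> move to those of length at least \<open>Suc n\<close>.\<close>
  define \<alpha> where "\<alpha> x = x @ (case (if True \<in> set x then None else Some False) of None \<Rightarrow> [] | Some b \<Rightarrow> [b])"
    for x :: "bool list"
  have \<alpha>1: "\<alpha> x = x" if "True \<in> set x" for x
    using that by (simp add: \<alpha>_def)
  have \<alpha>0: "\<alpha> (replicate i False) = replicate (Suc i) False" for i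
    by (simp add: \<alpha>_def replicate_append_same)
  have "bij_betw \<alpha> (- ?Z n) (- ?Z (Suc n))"
  proof (rule bij_betw_imageI)
    show "inj_on \<alpha> (- ?Z n)"
      by (auto simp: inj_on_def \<alpha>_def split: if_splits)
    have rep: "replicate i False \<in> ?Z m \<longleftrightarrow> i < m" for i m
      by auto
    have one: "x \<notin> ?Z m" if "True \<in> set x" for x m
      using that by auto
    show "\<alpha> ` (- ?Z n) = - ?Z (Suc n)"
    proof (intro equalityI subsetI)
      fix y assume "y \<in> \<alpha> ` (- ?Z n)"
      then obtain x where x: "x \<notin> ?Z n" "y = \<alpha> x"
        by auto
      show "y \<in> - ?Z (Suc n)"
      proof (cases "True \<in> set x")
        case True
        then show ?thesis using x \<alpha>1 one by (metis ComplI)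
      next
        case False
        then obtain i where i: "x = replicate i False"
          using no_True_iff by blast
        then show ?thesis using x \<alpha>0[of i] rep[of i n] rep[of "Suc i" "Suc n"] by simp
      qed
    next
      fix y assume y: "y \<in> - ?Z (Suc n)"
      show "y \<in> \<alpha> ` (- ?Z n)"
      proof (cases "True \<in> set y")
        case True
        then show ?thesis using \<alpha>1 one by (metis ComplI image_eqI)
      next
        case False
        then obtain i where i: "y = replicate i False"
          using no_True_iff by blast
        then have "Suc n \<le> i"
          using y rep[of i "Suc n"] by simp
        then obtain j where "i = Suc j" "n \<le> j"
          by (cases i) auto
        then show ?thesis
          using i \<alpha>0[of j] rep[of j n] by (metis ComplI image_eqI linorder_not_le)
      qed
    qed
  qed
  from bij_betw_trans[OF f'(2) this]
  have "bij_betw (\<lambda>x. \<alpha> (f' x)) A (- ?Z (Suc n))"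
    by (simp add: o_def)
  moreover have "poly_time_computable (\<lambda>x. \<alpha> (f' x))"
    unfolding \<alpha>_def using poly_time_comp[OF f'(1) poly_time_append_bit] .
  ultimately show ?case
    by blast
qed

text \<open>An enumeration sends \<open>B\<close> to the zero blocks shorter than
  \<open>card B\<close>, exactly those that the modified compression of \<open>A\<close>
  avoids.\<close>

lemma complementary_compressions:
  assumes "P_compressible A" "finite B"
  obtains f g U where "poly_time_computable f" "bij_betw f A (- U)"
    "poly_time_computable g" "bij_betw g B U"
proof -
  let ?U = "(\<lambda>i. replicate i False) ` {..<card B}"
  obtain f where f: "poly_time_computable f" "bij_betw f A (- ?U)"
    using assms(1) poly_time_free_zeros unfolding P_compressible_iff by blast
  obtain \<psi> where "bij_betw \<psi> B {..<card B}"
    using ex_bij_betw_finite_nat[OF assms(2)] by (auto simp: atLeast0LessThan)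
  moreover have "bij_betw (\<lambda>i. replicate i False) {..<card B} ?U"
    by (auto simp: bij_betw_def inj_on_def)
  ultimately have "bij_betw (\<lambda>x. replicate (\<psi> x) False) B ?U"
    using bij_betw_trans by (fastforce simp: o_def)
  \<comment> \<open>The default value \<open>[]\<close> outside \<open>B\<close> gives the function
    finite support and thereby makes it computable.\<close>
  then have "bij_betw (\<lambda>x. if x \<in> B then replicate (\<psi> x) False else []) B ?U"
    by (subst bij_betw_cong[where g = "\<lambda>x. replicate (\<psi> x) False"]) auto
  moreover have "poly_time_computable (\<lambda>x. if x \<in> B then replicate (\<psi> x) False else [])"
    using assms(2) by (intro poly_time_finite_support) (auto elim: finite_subset[rotated])
  ultimately show thesis
    using f that by blast
qed

theorem theorem30:
  fixes A B :: "bool list set"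
  assumes "A \<in> P_compressible'" and "B \<in> P_compressible'"
  shows "A \<oplus> B \<in> P_compressible'"
proof -
  consider "P_compressible A" "P_compressible B" | "P_compressible A" "finite B"
    | "finite A" "P_compressible B" | "finite A" "finite B"
    using assms by (auto simp: P_compressible'_def)
  then show ?thesis
  proof cases
    case 1
    then show ?thesis
      by (simp add: P_compressible'_def P_compressible_join)
  next
    case 2
    then obtain f g U where "poly_time_computable f" "bij_betw f A (- U)"
        "poly_time_computable g" "bij_betw g B U"
      by (rule complementary_compressions)
    then have "P_compressible (A \<oplus> B)"
      \<comment> \<open>The first component \<open>A\<close> is infinite here and fills
        \<open>- U\<close>, so the roles of \<open>U\<close> and its complement are
        exchanged.\<close>
      by (intro P_compressible_joinI[where F = "\<lambda>b. if b then g else f" and U = "- U"]) auto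
    then show ?thesis
      by (simp add: P_compressible'_def)
  next
    case 3
    then obtain f g U where "poly_time_computable f" "bij_betw f B (- U)"
        "poly_time_computable g" "bij_betw g A U"
      using complementary_compressions by metis
    then have "P_compressible (A \<oplus> B)"
      by (intro P_compressible_joinI[where F = "\<lambda>b. if b then f else g" and U = U]) auto
    then show ?thesis
      by (simp add: P_compressible'_def)
  next
    case 4
    then have "finite (A \<oplus> B)"
      by (simp add: join_def)
    then show ?thesis
      by (simp add: P_compressible'_def)
  qed
qed

end
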